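(* Let $A(s,T)\in 1+s\mathbb{Z}_q[[T]][[s]]$ be a $T$-adic entire series in $s$. If $t\in\mathbb{C}_p$ satisfies $0\neq|t|_p<1$, then $$t\text{-adic NP of }A(s,t)\ \geq\ T\text{-adic NP of }A(s,T).$$ Moreover, equality holds for one $t\in\mathbb{C}_p$ with $0\neq |t|_p<1$ if and only if it holds for all $t\in\mathbb{C}_p$ with $0\neq|t|_p<1$.
   Context: $p$ is a prime, $q$ a power of $p$, $\mathbb{Z}_q=W(\mathbb{F}_q)$ the ring of Witt vectors of $\mathbb{F}_q$, $\mathbb{C}_p$ the $p$-adic completion of an algebraic closure of $\mathbb{Q}_p$ (containing $\mathbb{Z}_q$). $T$ and $s$ are independent variables. A series $A(s,T)=\sum_{i\ge0} a_i(T)s^i$ with $a_i(T)\in\mathbb{Z}_q[[T]]$ is $T$-adic entire in $s$ if $\mathrm{ord}_T(a_i)/i\to\infty$. For $t\in\mathbb{C}_p$ with $0\ne|t|_p<1$, $A(s,t)=\sum_i a_i(t)s^i$ denotes the specialization $T\mapsto t$. NP means Newton polygon. The $T$-adic NP of $A(s,T)$ is the lower convex hull of the points $(i,\mathrm{ord}_T(a_i(T)))$, $i\geq 0$, regarded as a convex function on $\mathbb{R}_+$ (value $+\infty$ where nothing lies below). The $t$-adic NP of $A(s,t)$ is the lower convex hull of the points $(i,\mathrm{ord}_t(a_i(t)))$, where $\mathrm{ord}_t$ is the valuation of $\mathbb{C}_p$ normalized by $\mathrm{ord}_t(t)=1$. The inequality is one of functions on $\mathbb{R}_+$. *)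

theory Defs
  imports
    "HOL-Analysis.Analysis"
    "HOL-Computational_Algebra.Computational_Algebra"
    "HOL-Library.Poly_Mapping"
begin

section \<open>The field of p-adic complex numbers\<close>

text \<open>Fields with a non-archimedean absolute value; the absolute value induces the metric, so
  that the limits, closures, infinite sums and completeness of the library refer to it.\<close>

class nonarch_field = field + metric_space +
  assumes dist_diff: "dist x y = dist (x - y) 0"
    and dist_mult_zero: "dist (x * y) 0 = dist x 0 * dist y 0"
    and dist_ultrametric: "dist x z \<le> max (dist x y) (dist y z)"

definition vabs :: "'a::nonarch_field \<Rightarrow> real" where
  "vabs x = dist x 0"

text \<open>In a complete field whose absolute value restricts to the p-adic one on the rationals, the
  closure of the rationals is their completion, i.e. the field of p-adic numbers.\<close>

definition Qp :: "'a::{nonarch_field, field_char_0, complete_space} set" where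
  "Qp = closure \<rat>"

definition Qp_bar :: "'a::{nonarch_field, field_char_0, complete_space} set" where
  "Qp_bar = {x. \<exists>f. f \<noteq> 0 \<and> (\<forall>i. coeff f i \<in> Qp) \<and> poly f x = 0}"

text \<open>The type is the completion of an algebraic closure of the field of p-adic numbers: it is
  complete (by its sort), and it contains an algebraic closure of that field as a dense subset.\<close>

definition is_Cp :: "nat \<Rightarrow> 'a::{nonarch_field, field_char_0, complete_space} itself \<Rightarrow> bool" where
  "is_Cp p _ \<longleftrightarrow>
     (\<forall>n>0. vabs (of_nat n :: 'a) = 1 / real p ^ multiplicity p n) \<and>
     (\<forall>f :: 'a poly. degree f > 0 \<and> (\<forall>i. coeff f i \<in> Qp_bar) \<longrightarrow> (\<exists>x\<in>Qp_bar. poly f x = 0)) \<and>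
     closure (Qp_bar :: 'a set) = UNIV"


section \<open>Witt vectors\<close>

text \<open>Integer polynomials in two sequences of variables \<open>X\<^sub>0, X\<^sub>1, \<dots>\<close> (indexed by \<open>Inl\<close>) and
  \<open>Y\<^sub>0, Y\<^sub>1, \<dots>\<close> (indexed by \<open>Inr\<close>); an exponent vector is a finitely supported function.\<close>

type_synonym witt_mpoly = "((nat + nat) \<Rightarrow>\<^sub>0 nat) \<Rightarrow>\<^sub>0 int"

definition mpoly_var :: "nat + nat \<Rightarrow> witt_mpoly" where
  "mpoly_var v = Poly_Mapping.single (Poly_Mapping.single v 1) 1"

definition mpoly_eval :: "(nat + nat \<Rightarrow> 'k::comm_ring_1) \<Rightarrow> witt_mpoly \<Rightarrow> 'k" where
  "mpoly_eval \<alpha> f =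
     (\<Sum>e\<in>Poly_Mapping.keys f. of_int (Poly_Mapping.lookup f e) *
        (\<Prod>v\<in>Poly_Mapping.keys e. \<alpha> v ^ Poly_Mapping.lookup e v))"

definition ghost :: "nat \<Rightarrow> nat \<Rightarrow> (nat \<Rightarrow> 'r::comm_ring_1) \<Rightarrow> 'r" where
  "ghost p n x = (\<Sum>i\<le>n. of_nat p ^ i * x i ^ (p ^ (n - i)))"

text \<open>By a classical theorem of Witt, for a prime p and for addition and multiplication as
  \<open>opn\<close> there is exactly one such sequence of integer polynomials.\<close>

definition witt_op_poly ::
    "nat \<Rightarrow> (witt_mpoly \<Rightarrow> witt_mpoly \<Rightarrow> witt_mpoly) \<Rightarrow> nat \<Rightarrow> witt_mpoly" where
  "witt_op_poly p opn = (THE S. \<forall>n.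
     ghost p n S = opn (ghost p n (\<lambda>i. mpoly_var (Inl i))) (ghost p n (\<lambda>i. mpoly_var (Inr i))))"

text \<open>The ring of p-typical Witt vectors over \<open>'k\<close> has all sequences in \<open>'k\<close> as its elements.\<close>

definition witt_add ::
    "nat \<Rightarrow> (nat \<Rightarrow> 'k::comm_ring_1) \<Rightarrow> (nat \<Rightarrow> 'k) \<Rightarrow> nat \<Rightarrow> 'k" where
  "witt_add p x y = (\<lambda>n. mpoly_eval (case_sum x y) (witt_op_poly p (+) n))"

definition witt_mult ::
    "nat \<Rightarrow> (nat \<Rightarrow> 'k::comm_ring_1) \<Rightarrow> (nat \<Rightarrow> 'k) \<Rightarrow> nat \<Rightarrow> 'k" where
  "witt_mult p x y = (\<lambda>n. mpoly_eval (case_sum x y) (witt_op_poly p (*) n))"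

definition witt_one :: "nat \<Rightarrow> 'k::comm_ring_1" where
  "witt_one = (\<lambda>n. if n = 0 then 1 else 0)"

text \<open>Embeddings of topological rings. For a finite field \<open>'k\<close> of characteristic p, the p-adic
  topology on Witt vectors is the product topology of the discrete topology. Continuity is
  essential: as an abstract ring, the Witt vectors also have embeddings into the p-adic complex
  numbers with unbounded image.\<close>

definition witt_embedding ::
    "nat \<Rightarrow> ((nat \<Rightarrow> 'k::{finite, field}) \<Rightarrow> 'a::nonarch_field) \<Rightarrow> bool" where
  "witt_embedding p \<iota> \<longleftrightarrow>
     (\<forall>x y. \<iota> (witt_add p x y) = \<iota> x + \<iota> y) \<and>
     (\<forall>x y. \<iota> (witt_mult p x y) = \<iota> x * \<iota> y) \<and>
     \<iota> witt_one = 1 \<and>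
     embedding_map (product_topology (\<lambda>_. discrete_topology UNIV) UNIV) euclidean \<iota>"


section \<open>Newton polygons\<close>

text \<open>The points at height \<open>\<infinity>\<close> are dropped. Where no point of the convex hull lies on the vertical
  line through \<open>x\<close>, the infimum is that of the empty set, i.e. \<open>\<infinity>\<close>.\<close>

definition newton_polygon :: "(nat \<Rightarrow> ereal) \<Rightarrow> real \<Rightarrow> ereal" where
  "newton_polygon v x =
     Inf (ereal ` {y. (x, y) \<in> convex hull {(real i, h) |i h. v i = ereal h}})"

definition ord_T :: "'a::zero fps \<Rightarrow> ereal" where
  "ord_T a = (if a = 0 then \<infinity> else ereal (real (subdegree a)))"

definition ord_at :: "'a::nonarch_field \<Rightarrow> 'a \<Rightarrow> ereal" where
  "ord_at t x = (if x = 0 then \<infinity> else ereal (log (vabs t) (vabs x)))"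

text \<open>A series in \<open>s\<close> whose coefficients are series in \<open>T\<close> has type \<open>'a fps fps\<close>:
  the outer variable is \<open>s\<close>, the inner one is \<open>T\<close>.\<close>

definition T_adic_entire :: "'a::zero fps fps \<Rightarrow> bool" where
  "T_adic_entire A \<longleftrightarrow> (\<lambda>i. ord_T (fps_nth A i) / ereal (real i)) \<longlonglongrightarrow> \<infinity>"

definition specialize :: "'a::nonarch_field fps fps \<Rightarrow> 'a \<Rightarrow> 'a fps" where
  "specialize A t = Abs_fps (\<lambda>i. suminf (\<lambda>n. fps_nth (fps_nth A i) n * t ^ n))"

definition T_adic_NP :: "'a::zero fps fps \<Rightarrow> real \<Rightarrow> ereal" where
  "T_adic_NP A = newton_polygon (\<lambda>i. ord_T (fps_nth A i))"

definition t_adic_NP :: "'a::nonarch_field \<Rightarrow> 'a fps \<Rightarrow> real \<Rightarrow> ereal" where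
  "t_adic_NP t B = newton_polygon (\<lambda>i. ord_at t (fps_nth B i))"

end

theory Submission
  imports Defs
begin

text \<open>Write \<open>a\<^sub>i\<close> for the coefficients of \<open>A\<close>, and \<open>b\<^sub>i\<close> for the leading (lowest) coefficient of a
  nonzero \<open>a\<^sub>i\<close>, which has some order \<open>k\<close> in \<open>T\<close>. Elements of \<open>Zq\<close> have absolute value at most 1
  (\<open>witt_embedding_integral\<close>). So \<open>a\<^sub>i(t)\<close> is \<open>b\<^sub>i t^k\<close> up to an error smaller than \<open>\<bar>t\<bar>^k\<close>: its order
  at \<open>t\<close> is at least \<open>k\<close>, and it is \<open>k\<close> exactly if \<open>\<bar>b\<^sub>i\<bar> = 1\<close> (\<open>ord_at_specialize\<close>). Thus specialization
  can only raise the points that span the polygon, and the set of indices whose points stay in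
  place is the same for all \<open>t\<close>.

  The polygons are compared through their supporting lines. One polygon is
  below another as soon as, for every slope, a point of the first lies on a line of that
  slope that no point of the second is below
  (\<open>newton_polygon_le_if_supporting\<close>). For entire series, supporting lines of all slopes exist, and the
  inequality follows. If equality holds for one \<open>t\<close>, then for every slope the supporting line of the
  \<open>T\<close>-adic polygon passes through a point that \<open>t\<close> leaves in place (\<open>common_supporting_point\<close>).
  Every other \<open>t\<close> leaves that point in place too, and the same criterion gives
  equality for it.\<close>

section \<open>Non-archimedean absolute values\<close>

lemma vabs_nonneg: "0 \<le> vabs x"
  by (simp add: vabs_def)

lemma vabs_eq_0_iff: "vabs x = 0 \<longleftrightarrow> x = 0"
  by (simp add: vabs_def)

lemma vabs_zero: "vabs 0 = 0"
  by (simp add: vabs_def)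

lemma vabs_mult: "vabs (x * y) = vabs x * vabs y"
  by (simp add: vabs_def dist_mult_zero)

lemma vabs_one: "vabs (1::'a::nonarch_field) = 1"
proof -
  have "vabs (1::'a) * vabs (1::'a) = vabs (1::'a)"
    using vabs_mult[of "1::'a" 1] by simp
  moreover have "vabs (1::'a) \<noteq> 0"
    by (simp add: vabs_eq_0_iff)
  ultimately show ?thesis
    by simp
qed

lemma vabs_power: "vabs (x ^ n) = vabs x ^ n"
  by (induction n) (simp_all add: vabs_one vabs_mult)

lemma dist_eq_vabs: "dist x y = vabs (x - y)"
  unfolding vabs_def by (rule dist_diff)

lemma vabs_sum_le:
  assumes "\<And>i. i \<in> I \<Longrightarrow> vabs (f i) \<le> r" and "0 \<le> r"
  shows "vabs (sum f I) \<le> r"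
  using assms
proof (induction I rule: infinite_finite_induct)
  case (insert i I)
  have "vabs (f i + sum f I) \<le> max (dist (f i + sum f I) (sum f I)) (dist (sum f I) 0)"
    unfolding vabs_def by (rule dist_ultrametric)
  also have "\<dots> = max (vabs (f i)) (vabs (sum f I))"
    by (simp add: dist_eq_vabs)
  also have "\<dots> \<le> r"
    using insert by simp
  finally show ?case
    using insert.hyps by simp
qed (simp_all add: vabs_zero)

text \<open>An element of absolute value greater than 1 has unbounded powers, whereas the Witt vectors
  over a finite field form a compact multiplicative monoid.\<close>

lemma witt_embedding_integral:
  fixes \<iota> :: "(nat \<Rightarrow> 'k::{finite, field}) \<Rightarrow> 'a::nonarch_field"
  assumes "witt_embedding p \<iota>" and "x \<in> range \<iota>"
  shows "vabs x \<le> 1"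
proof (rule ccontr)
  assume gt: "\<not> vabs x \<le> 1"
  let ?X = "product_topology (\<lambda>_::nat. discrete_topology (UNIV::'k set)) UNIV"
  have "embedding_map ?X euclidean \<iota>"
    using assms(1) by (simp add: witt_embedding_def)
  then have cont: "continuous_map ?X euclidean \<iota>"
    unfolding embedding_map_def
    by (rule continuous_map_into_fulltopology[OF homeomorphic_imp_continuous_map])
  have "compact_space ?X"
    by (simp add: compact_space_product_topology compact_space_discrete_topology)
  then have "compactin euclidean (\<iota> ` topspace ?X)"
    using cont unfolding compact_space_def by (rule image_compactin)
  then have "compact (range \<iota>)"
    by simp
  then have "bounded (range \<iota>)"
    by (rule compact_imp_bounded)
  then obtain b where b: "\<forall>y\<in>range \<iota>. dist 0 y \<le> b"
    unfolding bounded_any_center[where a = 0] by (elim exE)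
  have pow: "x ^ Suc n \<in> range \<iota>" for n
  proof (induction n)
    case 0
    then show ?case using assms(2) by simp
  next
    case (Suc n)
    then obtain y z where "x = \<iota> y" and "x ^ Suc n = \<iota> z"
      using assms(2) by blast
    then have "x ^ Suc (Suc n) = \<iota> (witt_mult p y z)"
      using assms(1) by (simp add: witt_embedding_def)
    then show ?case by blast
  qed
  obtain n where "b < vabs x ^ n"
    using gt real_arch_pow[of "vabs x" b] by auto
  moreover have "vabs x ^ n \<le> vabs x ^ Suc n"
    using gt by (intro power_increasing) auto
  moreover have "vabs x ^ Suc n \<le> b"
    unfolding vabs_power[symmetric] unfolding vabs_def dist_commute[of _ 0]
    by (rule bspec[OF b pow])
  ultimately show False by simp
qed


section \<open>Specialization of power series\<close>

text \<open>By the ultrametric inequality, a sum of terms that are all at most \<open>vabs t ^ (k + 1)\<close> is itself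
  that small. This bounds the tails, which gives convergence by completeness as well as the
  estimate.\<close>

lemma power_series_specialize_approx:
  fixes a :: "'a::{nonarch_field, complete_space} fps"
  assumes coeffs: "\<And>n. vabs (fps_nth a n) \<le> 1"
    and t: "vabs t < 1"
    and low: "\<And>n. n < k \<Longrightarrow> fps_nth a n = 0"
  shows "vabs (suminf (\<lambda>n. fps_nth a n * t ^ n) - fps_nth a k * t ^ k) \<le> vabs t ^ Suc k"
proof -
  let ?S = "\<lambda>N. \<Sum>n<N. fps_nth a n * t ^ n"
  have bound: "vabs (fps_nth a n * t ^ n) \<le> vabs t ^ M" if "M \<le> n" for n M
  proof -
    have "vabs (fps_nth a n * t ^ n) \<le> 1 * vabs t ^ n"
      unfolding vabs_mult vabs_power
      by (intro mult_right_mono coeffs zero_le_power vabs_nonneg)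
    also have "\<dots> \<le> vabs t ^ M"
      using t that by (simp add: power_decreasing vabs_nonneg)
    finally show ?thesis .
  qed
  have tail: "dist (?S N) (?S M) \<le> vabs t ^ M" if "M \<le> N" for M N
  proof -
    have "?S N - ?S M = (\<Sum>n=M..<N. fps_nth a n * t ^ n)"
      using that by (simp add: sum_diff_nat_ivl lessThan_atLeast0)
    then show ?thesis
      unfolding dist_eq_vabs by (auto intro!: vabs_sum_le bound simp: vabs_nonneg)
  qed
  have "Cauchy ?S"
  proof (rule CauchyI')
    fix e :: real
    assume "0 < e"
    then obtain M where M: "vabs t ^ M < e"
      using real_arch_pow_inv t by blast
    have "dist (?S m) (?S n) < e" if "M \<le> m" "m < n" for m n
    proof -
      have "dist (?S m) (?S n) \<le> vabs t ^ m"
        using tail[of m n] that by (simp add: dist_commute)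
      also have "\<dots> \<le> vabs t ^ M"
        using t that by (simp add: power_decreasing vabs_nonneg)
      finally show ?thesis using M by simp
    qed
    then show "\<exists>M. \<forall>m\<ge>M. \<forall>n>m. dist (?S m) (?S n) < e" by blast
  qed
  then obtain L where L: "?S \<longlonglongrightarrow> L"
    using Cauchy_convergent_iff convergent_def by blast
  have "suminf (\<lambda>n. fps_nth a n * t ^ n) = L"
    using L by (intro sums_unique[symmetric]) (simp add: sums_def)
  moreover have "?S (Suc k) = fps_nth a k * t ^ k"
    by (simp add: low)
  moreover have "dist L (?S (Suc k)) \<le> vabs t ^ Suc k"
  proof (rule tendsto_upperbound)
    show "(\<lambda>N. dist (?S N) (?S (Suc k))) \<longlonglongrightarrow> dist L (?S (Suc k))"
      using L by (intro tendsto_intros)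
    show "\<forall>\<^sub>F N in sequentially. dist (?S N) (?S (Suc k)) \<le> vabs t ^ Suc k"
      using tail eventually_sequentially by blast
  qed simp
  ultimately show ?thesis
    by (simp add: dist_eq_vabs)
qed

text \<open>With \<open>k\<close> the order in \<open>T\<close>, the terms after the leading one have absolute value at most
  \<open>vabs t ^ (k + 1)\<close>. The sum attains the larger value \<open>vabs t ^ k\<close> exactly if the leading term
  does, which is a condition on the leading coefficient alone.\<close>

lemma ord_at_specialize:
  fixes A :: "'a::{nonarch_field, complete_space} fps fps"
  assumes coeffs: "\<And>n. vabs (fps_nth (fps_nth A i) n) \<le> 1"
    and t: "vabs t \<noteq> 0" "vabs t < 1"
  shows ord_T_le_ord_at: "ord_T (fps_nth A i) \<le> ord_at t (fps_nth (specialize A t) i)"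
    and ord_at_eq_iff: "fps_nth A i \<noteq> 0 \<Longrightarrow>
      ord_at t (fps_nth (specialize A t) i) = ord_T (fps_nth A i) \<longleftrightarrow>
      vabs (fps_nth (fps_nth A i) (subdegree (fps_nth A i))) = 1"
proof -
  define a where "a = fps_nth A i"
  define k where "k = subdegree a"
  define b where "b = fps_nth a k"
  define L where "L = fps_nth (specialize A t) i"
  have L_eq: "L = suminf (\<lambda>n. fps_nth a n * t ^ n)"
    by (simp add: L_def a_def specialize_def)
  have pos: "0 < vabs t"
    using t vabs_nonneg[of t] by simp
  have b1: "vabs b \<le> 1"
    using coeffs by (simp add: a_def b_def)
  have "vabs (L - b * t ^ k) \<le> vabs t ^ Suc k"
    unfolding L_eq b_def
  proof (rule power_series_specialize_approx)
    show "vabs (fps_nth a n) \<le> 1" for n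
      unfolding a_def by (rule coeffs)
    show "fps_nth a n = 0" if "n < k" for n
      using that unfolding k_def by (rule nth_less_subdegree_zero)
  qed (rule t)
  then have near: "dist L (b * t ^ k) \<le> vabs t ^ Suc k"
    by (simp add: dist_eq_vabs)
  have lead: "dist (b * t ^ k) 0 = vabs b * vabs t ^ k"
    by (simp add: vabs_def[symmetric] vabs_mult vabs_power)
  have small: "vabs t ^ Suc k < vabs t ^ k"
    using pos t by simp
  have le1: "vabs b * vabs t ^ k \<le> vabs t ^ k"
    using b1 pos by (simp add: mult_le_cancel_right)
  have upper: "vabs L \<le> vabs t ^ k"
    using dist_ultrametric[of L 0 "b * t ^ k"] near small le1 unfolding lead
    by (simp add: vabs_def)
  have unit_iff: "vabs L = vabs t ^ k \<longleftrightarrow> vabs b = 1"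
  proof
    assume "vabs L = vabs t ^ k"
    then have "vabs t ^ k \<le> vabs b * vabs t ^ k"
      using dist_ultrametric[of L 0 "b * t ^ k"] near small unfolding lead
      by (simp add: vabs_def)
    then show "vabs b = 1"
      using b1 pos by (simp add: mult_le_cancel_right)
  next
    assume "vabs b = 1"
    then have "vabs t ^ k \<le> vabs L"
      using dist_ultrametric[of "b * t ^ k" 0 L] near small unfolding lead
      by (simp add: vabs_def dist_commute)
    then show "vabs L = vabs t ^ k"
      using upper by simp
  qed
  have log_power: "log (vabs t) (vabs t ^ k) = real k"
    using pos t by (simp add: log_nat_power)
  have "real k \<le> log (vabs t) (vabs L)" if "L \<noteq> 0"
  proof -
    have "0 < vabs L"
      using that vabs_nonneg[of L] vabs_eq_0_iff[of L] by simp
    then have "ln (vabs L) \<le> ln (vabs t ^ k)"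
      using upper by simp
    moreover have "ln (vabs t) < 0"
      using pos t by simp
    ultimately show ?thesis
      using pos by (simp add: log_def field_simps ln_realpow)
  qed
  moreover have "L = 0" if "a = 0"
    using that by (simp add: L_eq)
  ultimately show "ord_T (fps_nth A i) \<le> ord_at t (fps_nth (specialize A t) i)"
    unfolding L_def[symmetric] a_def[symmetric] by (auto simp: ord_T_def ord_at_def k_def)
  show "ord_at t (fps_nth (specialize A t) i) = ord_T (fps_nth A i) \<longleftrightarrow>
      vabs (fps_nth (fps_nth A i) (subdegree (fps_nth A i))) = 1"
    if "fps_nth A i \<noteq> 0"
  proof -
    have "log (vabs t) (vabs L) = real k \<longleftrightarrow> vabs L = vabs t ^ k" if "L \<noteq> 0"
    proof -
      have "0 < vabs L"
        using that vabs_nonneg[of L] vabs_eq_0_iff[of L] by simp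
      then have "vabs t powr log (vabs t) (vabs L) = vabs L"
        using pos t by simp
      moreover have "vabs t powr real k = vabs t ^ k"
        using pos by (simp add: powr_realpow)
      ultimately show ?thesis
        using log_power by auto
    qed
    moreover have "vabs L \<noteq> vabs t ^ k" if "L = 0"
      using that pos by (simp add: vabs_zero)
    ultimately show ?thesis
      unfolding L_def[symmetric] a_def[symmetric] k_def[symmetric] b_def[symmetric]
      using unit_iff that by (auto simp: ord_T_def ord_at_def k_def a_def)
  qed
qed


section \<open>Newton polygons and supporting lines\<close>

lemma newton_polygon_upper:
  assumes "(x, y) \<in> convex hull {(real i, h) |i h. v i = ereal h}"
  shows "newton_polygon v x \<le> ereal y"
  unfolding newton_polygon_def using assms by (intro Inf_lower) simp

lemma newton_polygon_vertex: "v i = ereal h \<Longrightarrow> newton_polygon v (real i) \<le> ereal h"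
  by (rule newton_polygon_upper, rule hull_inc) auto

lemma hull_above_line:
  assumes "\<And>i. ereal (c + \<sigma> * real i) \<le> v i"
    and "(x, y) \<in> convex hull {(real i, h) |i h. v i = ereal h}"
  shows "c + \<sigma> * x \<le> y"
proof -
  let ?H = "{z :: real \<times> real. inner (- \<sigma>, 1) z \<ge> c}"
  have "{(real i, h) |i h. v i = ereal h} \<subseteq> ?H"
  proof safe
    fix i h
    assume "v i = ereal h"
    then show "inner (- \<sigma>, 1) (real i, h) \<ge> c"
      using assms(1)[of i] by simp
  qed
  then have "convex hull {(real i, h) |i h. v i = ereal h} \<subseteq> ?H"
    by (intro hull_minimal convex_halfspace_ge)
  then have "(x, y) \<in> ?H"
    using assms(2) by blast
  then show ?thesis by simp
qed

lemma newton_polygon_above_line: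
  assumes "\<And>i. ereal (c + \<sigma> * real i) \<le> v i"
  shows "ereal (c + \<sigma> * x) \<le> newton_polygon v x"
  unfolding newton_polygon_def
  by (intro Inf_greatest) (use hull_above_line[OF assms] in auto)

text \<open>Superlinear growth leaves only finitely many points below a line of slope \<open>\<sigma>\<close> through the
  origin, so a line of that slope can be pushed up until it touches one of them.\<close>

lemma supporting_line_exists:
  fixes v :: "nat \<Rightarrow> ereal"
  assumes zero: "v 0 = 0" and nonneg: "\<And>i. 0 \<le> v i"
    and lim: "(\<lambda>i. v i / ereal (real i)) \<longlonglongrightarrow> \<infinity>"
  obtains i h where "v i = ereal h" and "\<And>j. ereal (h + \<sigma> * (real j - real i)) \<le> v j"
proof -
  define F where "F = {i. v i \<le> ereal (\<sigma> * real i)}"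
  have "\<forall>\<^sub>F i in sequentially. ereal \<sigma> < v i / ereal (real i)"
    using lim unfolding tendsto_PInfty by blast
  then obtain N where N: "\<And>i. N \<le> i \<Longrightarrow> ereal \<sigma> < v i / ereal (real i)"
    unfolding eventually_sequentially by blast
  have "i < Suc N" if "i \<in> F" for i
  proof (rule ccontr)
    assume "\<not> i < Suc N"
    then have "ereal \<sigma> < v i / ereal (real i)" "0 < real i"
      using N[of i] by auto
    then show False
      using that by (cases "v i") (auto simp: F_def field_simps)
  qed
  then have fin: "finite F"
    by (intro finite_subset[of F "{..<Suc N}"]) auto
  have "0 \<in> F"
    using zero by (simp add: F_def)
  define g where "g i = real_of_ereal (v i) - \<sigma> * real i" for i
  obtain i where i: "i \<in> F" and min: "\<And>j. j \<in> F \<Longrightarrow> g i \<le> g j"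
    using fin \<open>0 \<in> F\<close> by (metis arg_min_if_finite(1) arg_min_least empty_iff)
  have real: "v j = ereal (g j + \<sigma> * real j)" if "j \<in> F" for j
    using that nonneg[of j] by (cases "v j") (auto simp: F_def g_def)
  have "g i \<le> 0"
    using min[OF \<open>0 \<in> F\<close>] zero by (simp add: g_def)
  have "ereal (g i + \<sigma> * real j) \<le> v j" for j
  proof (cases "j \<in> F")
    case True
    then show ?thesis
      using min[OF True] real[OF True] by simp
  next
    case False
    then have "ereal (\<sigma> * real j) \<le> v j"
      by (simp add: F_def)
    moreover have "ereal (g i + \<sigma> * real j) \<le> ereal (\<sigma> * real j)"
      using \<open>g i \<le> 0\<close> by simp
    ultimately show ?thesis
      by (rule order_trans[rotated])
  qed
  then show ?thesis
    using that[OF real[OF i]] by (simp add: algebra_simps)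
qed

text \<open>A convex-duality criterion. If the polygon of \<open>u\<close> were above a point \<open>(x, y)\<close> of the hull of
  \<open>v\<close>, a line would separate the downward ray at \<open>(x, y)\<close> from the hull of \<open>u\<close>; unless it is
  vertical, its slope contradicts the hypothesis. A vertical separating line can only
  occur at an end of the horizontal range of \<open>u\<close>: at the left end \<open>x = 0\<close> the point
  \<open>(0, 0)\<close> settles the claim, and at the right end a sufficiently steep slope does.\<close>

lemma newton_polygon_le_if_supporting:
  fixes u v :: "nat \<Rightarrow> ereal"
  assumes zero: "u 0 = 0" and u_nonneg: "\<And>i. 0 \<le> u i" and v_nonneg: "\<And>i. 0 \<le> v i"
    and support: "\<And>\<sigma>. \<exists>i h. u i = ereal h \<and> (\<forall>j. ereal (h + \<sigma> * (real j - real i)) \<le> v j)"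
    and x: "0 \<le> x"
  shows "newton_polygon u x \<le> newton_polygon v x"
proof -
  let ?U = "{(real i, h) |i h. u i = ereal h}"
  let ?V = "{(real i, h) |i h. v i = ereal h}"
  have "newton_polygon u x \<le> ereal y" if xy: "(x, y) \<in> convex hull ?V" for y
  proof (rule ccontr)
    assume "\<not> newton_polygon u x \<le> ereal y"
    then have "ereal y < newton_polygon u x"
      by simp
    \<comment> \<open>Separation of disjoint convex sets is only weak; the gap between \<open>y\<close> and \<open>y'\<close> makes up for
      the lost strictness.\<close>
    then obtain y' where y': "y < y'" "ereal y' < newton_polygon u x"
      using ereal_dense2 by force
    have y0: "0 \<le> y"
      using hull_above_line[of 0 0 v x y] v_nonneg xy by (simp add: zero_ereal_def)
    have support': "\<exists>i h. u i = ereal h \<and> h + \<sigma> * (x - real i) \<le> y" for \<sigma>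
    proof -
      obtain i h where *: "u i = ereal h" "\<And>j. ereal (h + \<sigma> * (real j - real i)) \<le> v j"
        using support by blast
      have "(h - \<sigma> * real i) + \<sigma> * x \<le> y"
        using *(2) by (intro hull_above_line[OF _ xy]) (simp add: algebra_simps)
      then show ?thesis
        using *(1) by (auto simp: algebra_simps)
    qed
    have x_pos: "0 < x"
    proof (rule ccontr)
      assume "\<not> 0 < x"
      then have "newton_polygon u x \<le> ereal 0"
        using x newton_polygon_vertex[of u 0 0] zero by (simp add: zero_ereal_def)
      then show False
        using \<open>ereal y < newton_polygon u x\<close> y0
        by (meson ereal_less_eq(3) less_le_not_le order_trans)
    qed
    have right: "\<exists>i h. u i = ereal h \<and> x < real i"
    proof (rule ccontr)
      assume none: "\<not> (\<exists>i h. u i = ereal h \<and> x < real i)"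
      define n where "n = nat \<lceil>x\<rceil> - 1"
      define d where "d = x - real n"
      have d: "0 < d" and below: "\<And>i. real i < x \<Longrightarrow> i \<le> n"
        unfolding d_def n_def using x_pos by linarith+
      \<comment> \<open>Steep enough that no index left of \<open>x\<close>, all at distance at least \<open>d\<close>, can carry the
        supporting line.\<close>
      define \<sigma> where "\<sigma> = y / d + 1"
      obtain i h where ih: "u i = ereal h" "h + \<sigma> * (x - real i) \<le> y"
        using support' by blast
      have h0: "0 \<le> h"
        using u_nonneg[of i] ih(1) by simp
      have "real i \<le> x"
        using none ih(1) by force
      moreover have "\<not> real i < x"
      proof
        assume "real i < x"
        then have "d \<le> x - real i"
          using below[of i] by (simp add: d_def)
        then have "\<sigma> * d \<le> \<sigma> * (x - real i)"
          using y0 d by (intro mult_left_mono) (simp_all add: \<sigma>_def)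
        moreover have "\<sigma> * d = y + d"
          using d by (simp add: \<sigma>_def field_simps)
        ultimately show False
          using ih(2) h0 d by simp
      qed
      ultimately have "x = real i"
        by simp
      then have "newton_polygon u x \<le> ereal y"
        using newton_polygon_vertex[of u i h, OF ih(1)] ih(2)
        by (metis add.right_neutral diff_self ereal_less_eq(3) mult_zero_right order_trans)
      then show False
        using \<open>\<not> newton_polygon u x \<le> ereal y\<close> by contradiction
    qed
    let ?R = "{x} \<times> {..y'}"
    have "(x, z) \<notin> convex hull ?U" if "z \<le> y'" for z
      using newton_polygon_upper[of x z u] y'(2) that
      by (meson ereal_less_eq(3) leD order_trans)
    then have "?R \<inter> convex hull ?U = {}"
      by auto
    moreover have "convex ?R"
      by (intro convex_Times) auto
    moreover have "(0::real, 0::real) \<in> convex hull ?U"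
      using zero by (intro hull_inc) (auto simp: zero_ereal_def)
    then have "convex hull ?U \<noteq> {}"
      by blast
    ultimately have "\<exists>a b. a \<noteq> 0 \<and> (\<forall>z\<in>?R. inner a z \<le> b) \<and>
        (\<forall>z\<in>convex hull ?U. inner a z \<ge> b)"
      by (intro separating_hyperplane_sets convex_convex_hull) simp_all
    then obtain a b where ab: "a \<noteq> 0" "\<forall>z\<in>?R. inner a z \<le> b"
        "\<forall>z\<in>convex hull ?U. b \<le> inner a z"
      by (elim exE conjE)
    obtain a1 a2 where a: "a = (a1, a2)"
      by (cases a)
    have ray: "a1 * x + a2 * z \<le> b" if "z \<le> y'" for z
      using ab(2) that a by auto
    have pts: "b \<le> a1 * real i + a2 * h" if "u i = ereal h" for i h
    proof -
      have "(real i, h) \<in> convex hull ?U"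
        using that by (intro hull_inc) auto
      then show ?thesis
        using ab(3) a by auto
    qed
    have a2_nonneg: "0 \<le> a2"
    proof (rule ccontr)
      assume "\<not> 0 \<le> a2"
      then have neg: "a2 < 0" by simp
      define z where "z = min y' ((b - a1 * x + 1) / a2)"
      have "(b - a1 * x + 1) = a2 * ((b - a1 * x + 1) / a2)"
        using neg by simp
      also have "\<dots> \<le> a2 * z"
        using neg by (intro mult_left_mono_neg) (auto simp: z_def)
      finally show False
        using ray[of z] by (simp add: z_def)
    qed
    have a2_pos: "0 < a2"
    proof (rule ccontr)
      assume "\<not> 0 < a2"
      then have a2: "a2 = 0" using a2_nonneg by simp
      then have a1: "a1 \<noteq> 0" using ab(1) a by (auto simp: zero_prod_def)
      obtain i h where ih: "u i = ereal h" "x < real i"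
        using right by blast
      have "a1 * x \<le> 0"
        using ray[of y'] pts[of 0 0] zero a2 by (simp add: zero_ereal_def)
      moreover have "a1 * x \<le> a1 * real i"
        using ray[of y'] pts[OF ih(1)] a2 by simp
      ultimately show False
        using a1 x_pos ih(2) by (auto simp: mult_le_0_iff mult_le_cancel_left)
    qed
    obtain i h where ih: "u i = ereal h" "h + (- a1 / a2) * (x - real i) \<le> y"
      using support' by blast
    have "a2 * (h + (- a1 / a2) * (x - real i)) \<le> a2 * y"
      using ih(2) a2_pos by (intro mult_left_mono) auto
    moreover have "a2 * (h + (- a1 / a2) * (x - real i)) = a2 * h - a1 * (x - real i)"
      using a2_pos by (simp add: distrib_left right_diff_distrib)
    ultimately have "a2 * h + a1 * real i \<le> a2 * y + a1 * x"
      by (simp add: right_diff_distrib)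
    moreover have "a2 * y < a2 * y'"
      using y'(1) a2_pos by simp
    ultimately show False
      using ray[of y'] pts[OF ih(1)] by simp
  qed
  then show ?thesis
    unfolding newton_polygon_def[of v] by (intro Inf_greatest) auto
qed

text \<open>Conversely, raise a line of slope \<open>\<sigma>\<close> until it supports \<open>w\<close>. If it lay strictly above the
  one that supports \<open>v\<close>, the polygon of \<open>w\<close> would exceed that of \<open>v\<close> at the index where the
  latter line touches \<open>v\<close>. So both lines agree. Where the common line touches \<open>w\<close>, the value of
  \<open>v\<close> is squeezed between the line and \<open>w\<close>, so \<open>v\<close> and \<open>w\<close> coincide there.\<close>

lemma common_supporting_point:
  fixes v w :: "nat \<Rightarrow> ereal"
  assumes v: "v 0 = 0" "\<And>i. 0 \<le> v i" "(\<lambda>i. v i / ereal (real i)) \<longlonglongrightarrow> \<infinity>"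
    and w: "w 0 = 0" "(\<lambda>i. w i / ereal (real i)) \<longlonglongrightarrow> \<infinity>"
    and le: "\<And>i. v i \<le> w i"
    and NP: "\<And>x. 0 \<le> x \<Longrightarrow> newton_polygon w x \<le> newton_polygon v x"
  shows "\<exists>i h. w i = ereal h \<and> v i = ereal h \<and>
    (\<forall>j. ereal (h + \<sigma> * (real j - real i)) \<le> v j)"
proof -
  have w_nonneg: "0 \<le> w i" for i
    using v(2) le by (rule order_trans)
  obtain i h where vi: "v i = ereal h" "\<And>j. ereal (h + \<sigma> * (real j - real i)) \<le> v j"
    using supporting_line_exists[OF v, of \<sigma>] by blast
  obtain k g where wk: "w k = ereal g" "\<And>j. ereal (g + \<sigma> * (real j - real k)) \<le> w j"
    using supporting_line_exists[OF w(1) w_nonneg w(2), of \<sigma>] by blast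
  have "ereal ((g - \<sigma> * real k) + \<sigma> * real i) \<le> newton_polygon w (real i)"
    using wk(2) by (intro newton_polygon_above_line) (simp add: algebra_simps)
  also have "\<dots> \<le> newton_polygon v (real i)"
    by (rule NP) simp
  also have "\<dots> \<le> ereal h"
    by (rule newton_polygon_vertex[of v i h, OF vi(1)])
  finally have upper: "g + \<sigma> * (real i - real k) \<le> h"
    by (simp add: algebra_simps)
  have "v k \<le> ereal g"
    using le[of k] wk(1) by simp
  moreover have "ereal g \<le> ereal (h + \<sigma> * (real k - real i))"
    using upper by (simp add: algebra_simps)
  ultimately have vk: "v k = ereal g" "g = h + \<sigma> * (real k - real i)"
    using vi(2)[of k] by (cases "v k"; simp)+
  have "ereal (g + \<sigma> * (real j - real k)) \<le> v j" for j
  proof -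
    have "g + \<sigma> * (real j - real k) = h + \<sigma> * (real j - real i)"
      using vk(2) by (simp add: algebra_simps)
    then show ?thesis
      using vi(2)[of j] by simp
  qed
  then show ?thesis
    using wk(1) vk(1) by blast
qed


section \<open>Specialization of Newton polygons\<close>

theorem theorem1p2:
  fixes p q m :: nat
    and \<iota> :: "(nat \<Rightarrow> 'k::{finite, field}) \<Rightarrow> 'a::{nonarch_field, field_char_0, complete_space}"
    and Zq :: "'a set"
    and A :: "'a fps fps"
  assumes "prime p" and "m \<ge> 1" and "q = p ^ m" and "CARD('k) = q"
    and "is_Cp p TYPE('a)"
    and "witt_embedding p \<iota>" and "Zq = range \<iota>"
    and "fps_nth A 0 = 1" and "\<forall>i j. fps_nth (fps_nth A i) j \<in> Zq"
    and "T_adic_entire A"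
  shows "(\<forall>t::'a. vabs t \<noteq> 0 \<and> vabs t < 1 \<longrightarrow>
            (\<forall>x\<ge>0. t_adic_NP t (specialize A t) x \<ge> T_adic_NP A x)) \<and>
         ((\<exists>t::'a. vabs t \<noteq> 0 \<and> vabs t < 1 \<and>
             (\<forall>x\<ge>0. t_adic_NP t (specialize A t) x = T_adic_NP A x)) \<longleftrightarrow>
          (\<forall>t::'a. vabs t \<noteq> 0 \<and> vabs t < 1 \<longrightarrow>
             (\<forall>x\<ge>0. t_adic_NP t (specialize A t) x = T_adic_NP A x)))"
proof -
  have coeffs: "vabs (fps_nth (fps_nth A i) n) \<le> 1" for i n
    using witt_embedding_integral assms by blast
  define v where "v i = ord_T (fps_nth A i)" for i
  define w where "w t i = ord_at t (fps_nth (specialize A t) i)" for t i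
  define unit where
    "unit i \<longleftrightarrow> vabs (fps_nth (fps_nth A i) (subdegree (fps_nth A i))) = 1" for i
  have NP_v: "T_adic_NP A x = newton_polygon v x" for x
    by (simp add: T_adic_NP_def v_def[abs_def])
  have NP_w: "t_adic_NP t (specialize A t) x = newton_polygon (w t) x" for t x
    by (simp add: t_adic_NP_def w_def[abs_def])
  have v0: "v 0 = 0"
    using assms(8) by (simp add: v_def ord_T_def zero_ereal_def)
  have v_nonneg: "0 \<le> v i" for i
    by (simp add: v_def ord_T_def)
  have v_lim: "(\<lambda>i. v i / ereal (real i)) \<longlonglongrightarrow> \<infinity>"
    using assms(10) by (simp add: T_adic_entire_def v_def)
  have v_le_w: "v i \<le> w t i" if "vabs t \<noteq> 0" "vabs t < 1" for t i
    unfolding v_def w_def using coeffs that by (rule ord_T_le_ord_at)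
  have w_eq_iff: "w t i = v i \<longleftrightarrow> unit i" if "vabs t \<noteq> 0" "vabs t < 1" "v i = ereal h" for t i h
    unfolding v_def w_def unit_def using coeffs that(1,2)
    by (rule ord_at_eq_iff) (use that(3) in \<open>auto simp: v_def ord_T_def\<close>)
  have w0: "w t 0 = 0" if "vabs t \<noteq> 0" "vabs t < 1" for t
    using w_eq_iff[OF that, of 0 0] v0 assms(8) by (simp add: unit_def vabs_one zero_ereal_def)
  have w_nonneg: "0 \<le> w t i" if "vabs t \<noteq> 0" "vabs t < 1" for t i
    using v_nonneg v_le_w[OF that] by (rule order_trans)
  have w_lim: "(\<lambda>i. w t i / ereal (real i)) \<longlonglongrightarrow> \<infinity>" if "vabs t \<noteq> 0" "vabs t < 1" for t
    unfolding tendsto_PInfty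
  proof
    fix r
    have "\<forall>\<^sub>F i in sequentially. ereal r < v i / ereal (real i)"
      using v_lim unfolding tendsto_PInfty by blast
    then show "\<forall>\<^sub>F i in sequentially. ereal r < w t i / ereal (real i)"
      using eventually_gt_at_top[of 0]
    proof eventually_elim
      case (elim i)
      then show ?case
        using ereal_divide_right_mono[OF v_le_w[OF that, of i], of "ereal (real i)"] by simp
    qed
  qed
  have ge: "newton_polygon v x \<le> newton_polygon (w t) x"
    if t: "vabs t \<noteq> 0" "vabs t < 1" and x: "0 \<le> x" for t x
  proof (rule newton_polygon_le_if_supporting)
    fix \<sigma>
    obtain i h where "v i = ereal h" "\<And>j. ereal (h + \<sigma> * (real j - real i)) \<le> v j"
      using supporting_line_exists[OF v0 v_nonneg v_lim, of \<sigma>] by blast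
    then show "\<exists>i h. v i = ereal h \<and> (\<forall>j. ereal (h + \<sigma> * (real j - real i)) \<le> w t j)"
      using v_le_w[OF t] by (meson order_trans)
  qed (use v0 v_nonneg w_nonneg[OF t] x in auto)
  have transfer: "newton_polygon (w t') x \<le> newton_polygon v x"
    if t: "vabs t \<noteq> 0" "vabs t < 1" and t': "vabs t' \<noteq> 0" "vabs t' < 1"
      and eq: "\<And>x. 0 \<le> x \<Longrightarrow> newton_polygon (w t) x = newton_polygon v x"
      and x: "0 \<le> x" for t t' x
  proof (rule newton_polygon_le_if_supporting)
    fix \<sigma>
    obtain i h where ih: "w t i = ereal h" "v i = ereal h"
        "\<forall>j. ereal (h + \<sigma> * (real j - real i)) \<le> v j"
      using common_supporting_point[OF v0 v_nonneg v_lim w0[OF t] w_lim[OF t] v_le_w[OF t], of \<sigma>]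
        eq by auto
    then have "w t' i = ereal h"
      using w_eq_iff[OF t ih(2)] w_eq_iff[OF t' ih(2)] by simp
    then show "\<exists>i h. w t' i = ereal h \<and> (\<forall>j. ereal (h + \<sigma> * (real j - real i)) \<le> v j)"
      using ih(3) by blast
  qed (use w0[OF t'] w_nonneg[OF t'] v_nonneg x in auto)
  \<comment> \<open>The residue characteristic itself shows that the range of \<open>t\<close> is not empty.\<close>
  have "vabs (of_nat p :: 'a) = 1 / real p"
    using assms(1,5) prime_gt_0_nat[OF assms(1)] by (simp add: is_Cp_def)
  moreover have "1 < p"
    using assms(1) by (rule prime_gt_1_nat)
  ultimately have "vabs (of_nat p :: 'a) \<noteq> 0 \<and> vabs (of_nat p :: 'a) < 1"
    by simp
  then show ?thesis
    unfolding NP_v NP_w using ge transfer by (meson order_antisym)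
qed

end
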